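(* Let $(M_t)_{t\ge0}$ be a $\rhd$-homogeneous Markov process on $\mathbb R$ with a filtration $(\mathcal F_t)_{t\ge0}$ such that $M_0=0$ and $\mathbb E|M_t|<\infty$ for all $t>0$. Then the process $(M_t-\mathbb E[M_t])_{t\ge0}$ is an $(\mathcal F_t)$-martingale.
   Context: $\mathbb{C}^+=\{z\in\mathbb{C}:\operatorname{Im} z>0\}$. For a probability measure $\mu$ on $\mathbb{R}$, $G_\mu(z)=\int_{\mathbb R}\frac{1}{z-x}\mu(dx)$ and $F_\mu=1/G_\mu$ on $\mathbb C^+$. The monotone convolution $\mu\rhd\nu$ is the probability measure with $F_{\mu\rhd\nu}=F_\mu\circ F_\nu$. Transition kernels on $\mathbb R$ are probability kernels $(k_{st})_{0\le s\le t}$ with $k_{ss}(x,\cdot)=\delta_x$ and $k_{su}(x,B)=\int k_{st}(x,dy)k_{tu}(y,B)$ for $s\le t\le u$. A Markov process with these kernels is a process $(M_t)$ adapted to a filtration $(\mathcal F_t)$ with $\mathbb P[M_t\in B|\mathcal F_s]=k_{st}(M_s,B)$ a.s. for $s\le t$ and Borel $B$. It is $\rhd$-homogeneous if $(s,t)\mapsto k_{st}(x,\cdot)$ is weakly continuous for every $x\in\mathbb R$ and $\delta_x\rhd k_{st}(y,\cdot)=k_{st}(x+y,\cdot)$ for all $x,y\in\mathbb R$, $0\le s\le t$. *)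

theory Defs
  imports "HOL-Probability.Probability"
begin

definition Cauchy_transform :: "real measure \<Rightarrow> complex \<Rightarrow> complex" where
  "Cauchy_transform \<mu> z = (\<integral>x. 1 / (z - complex_of_real x) \<partial>\<mu>)"

definition reciprocal_Cauchy_transform :: "real measure \<Rightarrow> complex \<Rightarrow> complex" where
  "reciprocal_Cauchy_transform \<mu> z = 1 / Cauchy_transform \<mu> z"

(* "\<mu> \<rhd> \<nu> = \<rho>", as a relation: \<rho> is the Borel probability measure on the line
   determined by F_\<rho> = F_\<mu> o F_\<nu> on the upper half-plane (which F_\<nu> maps to itself).
   The measure is unique by Stieltjes inversion. *)
definition is_monotone_convolution ::
    "real measure \<Rightarrow> real measure \<Rightarrow> real measure \<Rightarrow> bool" where
  "is_monotone_convolution \<mu> \<nu> \<rho> \<longleftrightarrow>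
     \<rho> \<in> space (prob_algebra borel) \<and>
     (\<forall>z. Im z > 0 \<longrightarrow>
        reciprocal_Cauchy_transform \<rho> z =
        reciprocal_Cauchy_transform \<mu> (reciprocal_Cauchy_transform \<nu> z))"

(* Time is [0, \<infinity>), embedded in the reals: k s t, F t and X t below are constrained only at
   nonnegative times, and k s t only for s \<le> t. *)

definition transition_kernels :: "(real \<Rightarrow> real \<Rightarrow> real \<Rightarrow> real measure) \<Rightarrow> bool" where
  "transition_kernels k \<longleftrightarrow>
     (\<forall>s t. 0 \<le> s \<and> s \<le> t \<longrightarrow> k s t \<in> borel \<rightarrow>\<^sub>M prob_algebra borel) \<and>
     (\<forall>s x. 0 \<le> s \<longrightarrow> k s s x = return borel x) \<and>
     (\<forall>s t u x. \<forall>B\<in>sets borel. 0 \<le> s \<and> s \<le> t \<and> t \<le> u \<longrightarrow>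
        emeasure (k s u x) B = (\<integral>\<^sup>+y. emeasure (k t u y) B \<partial>k s t x))"

(* Weak continuity is continuity for the topology induced by the maps \<mu> \<mapsto> \<integral>f d\<mu>,
   f bounded continuous. *)
definition monotone_homogeneous :: "(real \<Rightarrow> real \<Rightarrow> real \<Rightarrow> real measure) \<Rightarrow> bool" where
  "monotone_homogeneous k \<longleftrightarrow>
     (\<forall>x. \<forall>f::real \<Rightarrow> real. continuous_on UNIV f \<and> bounded (range f) \<longrightarrow>
        continuous_on {(s, t). 0 \<le> s \<and> s \<le> t} (\<lambda>(s, t). \<integral>y. f y \<partial>k s t x)) \<and>
     (\<forall>x y s t. 0 \<le> s \<and> s \<le> t \<longrightarrow>
        is_monotone_convolution (return borel x) (k s t y) (k s t (x + y)))"

definition filtered_prob_space :: "'a measure \<Rightarrow> (real \<Rightarrow> 'a measure) \<Rightarrow> bool" where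
  "filtered_prob_space P F \<longleftrightarrow>
     prob_space P \<and>
     (\<forall>t\<ge>0. subalgebra P (F t)) \<and>
     (\<forall>s t. 0 \<le> s \<and> s \<le> t \<longrightarrow> subalgebra (F t) (F s))"

definition adapted_process :: "(real \<Rightarrow> 'a measure) \<Rightarrow> (real \<Rightarrow> 'a \<Rightarrow> real) \<Rightarrow> bool" where
  "adapted_process F X \<longleftrightarrow> (\<forall>t\<ge>0. X t \<in> borel_measurable (F t))"

definition Markov_process ::
    "'a measure \<Rightarrow> (real \<Rightarrow> 'a measure) \<Rightarrow> (real \<Rightarrow> real \<Rightarrow> real \<Rightarrow> real measure) \<Rightarrow>
     (real \<Rightarrow> 'a \<Rightarrow> real) \<Rightarrow> bool" where
  "Markov_process P F k X \<longleftrightarrow>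
     filtered_prob_space P F \<and> transition_kernels k \<and> adapted_process F X \<and>
     (\<forall>s t. \<forall>B\<in>sets borel. 0 \<le> s \<and> s \<le> t \<longrightarrow>
        (AE \<omega> in P. real_cond_exp P (F s) (\<lambda>\<omega>'. indicator B (X t \<omega>')) \<omega> =
                    measure (k s t (X s \<omega>)) B))"

definition monotone_homogeneous_Markov_process ::
    "'a measure \<Rightarrow> (real \<Rightarrow> 'a measure) \<Rightarrow> (real \<Rightarrow> real \<Rightarrow> real \<Rightarrow> real measure) \<Rightarrow>
     (real \<Rightarrow> 'a \<Rightarrow> real) \<Rightarrow> bool" where
  "monotone_homogeneous_Markov_process P F k X \<longleftrightarrow>
     Markov_process P F k X \<and> monotone_homogeneous k"

definition martingale :: "'a measure \<Rightarrow> (real \<Rightarrow> 'a measure) \<Rightarrow> (real \<Rightarrow> 'a \<Rightarrow> real) \<Rightarrow> bool" where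
  "martingale P F X \<longleftrightarrow>
     filtered_prob_space P F \<and> adapted_process F X \<and>
     (\<forall>t\<ge>0. integrable P (X t)) \<and>
     (\<forall>s t. 0 \<le> s \<and> s \<le> t \<longrightarrow> (AE \<omega> in P. real_cond_exp P (F s) (X t) \<omega> = X s \<omega>))"

end

theory Submission
  imports Defs
begin

text \<open>
  If a probability measure has finite mean \<open>m\<close>, then \<open>z - 1 / G(z) \<rightarrow> m\<close> as \<open>z = iy \<rightarrow> i\<infinity>\<close>. Homogeneity says
  that the reciprocal Cauchy transforms of \<open>k s t (x + y)\<close> and \<open>k s t y\<close> differ by the constant
  \<open>x\<close>, so the mean of \<open>k s t x\<close> is \<open>x + c\<close> with the same \<open>c\<close> for all \<open>x\<close> at which it exists. Since
  \<open>M t\<close> is integrable, the mean exists for almost every value of \<open>M s\<close>, and the Markov property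
  gives \<open>E[M t | F s] = M s + c\<close>; taking expectations identifies \<open>c\<close>.
\<close>

section \<open>Means and reciprocal Cauchy transforms\<close>

text \<open>At \<open>z = x\<close> both sides are 0 because \<open>1 / 0 = 0\<close>. Hence the
  identity can be applied at a value of another transform without knowing where that value
  lies.\<close>

lemma reciprocal_Cauchy_transform_return:
  "reciprocal_Cauchy_transform (return borel x) z = z - complex_of_real x"
proof -
  have "(\<lambda>y. 1 / (z - complex_of_real y)) \<in> borel_measurable borel"
    by measurable
  then show ?thesis
    by (simp add: reciprocal_Cauchy_transform_def Cauchy_transform_def integral_return)
qed

text \<open>On the imaginary axis the distance from \<open>z\<close> to a real \<open>x\<close> is
  at least the modulus of \<open>z\<close>, so \<open>z * x / (z - x)\<close> is dominated by the
  modulus of \<open>x\<close>; it tends to \<open>x\<close>. Dominated convergence gives the limit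
  of \<open>L\<close>, and dividing by \<open>z * G(z)\<close>, which tends to 1, does not change
  it.\<close>

lemma reciprocal_Cauchy_transform_mean:
  assumes "prob_space \<mu>" and sets: "sets \<mu> = sets borel"
    and int: "integrable \<mu> (\<lambda>x. x)"
  shows "((\<lambda>y. \<i> * of_real y - reciprocal_Cauchy_transform \<mu> (\<i> * of_real y))
           \<longlongrightarrow> of_real (\<integral>x. x \<partial>\<mu>)) at_top"
proof -
  interpret prob_space \<mu> by fact
  have inv_lim: "((\<lambda>y. complex_of_real (inverse y)) \<longlongrightarrow> 0) at_top"
    using tendsto_of_real[OF tendsto_inverse_0_at_top[OF filterlim_ident], where 'a = complex]
    by (simp only: of_real_0)
  define z where "z y = \<i> * complex_of_real y" for y
  have [measurable_cong]: "sets \<mu> = sets borel" by fact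
  have z_norm: "norm (z y - of_real x) \<ge> y" for x y
    using abs_Im_le_cmod[of "z y - of_real x"] by (simp add: z_def)
  have ne: "z y - of_real x \<noteq> 0" if "y > 0" for x y
    using z_norm[of y x] that by auto
  have bound: "norm (z y * of_real x / (z y - of_real x)) \<le> norm x" if y: "y > 0" for x y
  proof -
    have "y * \<bar>x\<bar> \<le> norm (z y - of_real x) * \<bar>x\<bar>"
      by (rule mult_right_mono[OF z_norm]) simp
    then show ?thesis
      using y ne[OF y, of x]
      by (simp add: norm_divide norm_mult z_def field_simps)
  qed
  (* L y = z (z G(z) - 1) at z = z y, so that z - 1 / G(z) = L y / (z G(z)). *)
  define L where "L y = (\<integral>x. z y * of_real x / (z y - of_real x) \<partial>\<mu>)" for y
  have L_lim: "(L \<longlongrightarrow> (\<integral>x. of_real x \<partial>\<mu>)) at_top"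
    unfolding L_def
  proof (rule integral_dominated_convergence_at_top[where w = "\<lambda>x. \<bar>x\<bar>"])
    show "\<forall>\<^sub>F y in at_top. AE x in \<mu>. norm (z y * of_real x / (z y - of_real x)) \<le> \<bar>x\<bar>"
      using bound by (intro eventually_mono[OF eventually_gt_at_top[of 0]]) auto
    show "AE x in \<mu>. ((\<lambda>y. z y * of_real x / (z y - of_real x)) \<longlongrightarrow> of_real x) at_top"
    proof (rule AE_I2)
      fix x :: real
      \<comment> \<open>Cancelling \<open>z y\<close> and using \<open>1 / \<i> = - \<i>\<close>
        expresses the integrand through \<open>inverse y\<close>, which tends to 0.\<close>
      from inv_lim have "((\<lambda>y. of_real x / (1 + \<i> * of_real x * of_real (inverse y)))
          \<longlongrightarrow> of_real x / (1 + \<i> * of_real x * 0)) at_top"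
        by (intro tendsto_intros) auto
      moreover have "\<forall>\<^sub>F y in at_top. of_real x / (1 + \<i> * of_real x * of_real (inverse y))
          = z y * of_real x / (z y - of_real x)"
      proof (rule eventually_mono[OF eventually_gt_at_top[of 0]])
        fix y :: real assume y: "y > 0"
        have "z y - of_real x = z y * (1 + \<i> * of_real x * of_real (inverse y))"
          using y by (simp add: z_def algebra_simps flip: of_real_mult)
        moreover have "z y \<noteq> 0" using y by (simp add: z_def)
        ultimately show "of_real x / (1 + \<i> * of_real x * of_real (inverse y))
          = z y * of_real x / (z y - of_real x)"
          by simp
      qed
      ultimately show "((\<lambda>y. z y * of_real x / (z y - of_real x)) \<longlongrightarrow> of_real x) at_top"
        by (simp add: Lim_transform_eventually)
    qed
    show "integrable \<mu> (\<lambda>x. \<bar>x\<bar>)"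
      using int by simp
    show "(\<lambda>x. complex_of_real x) \<in> borel_measurable \<mu>"
      by measurable
    show "(\<lambda>x. z y * of_real x / (z y - of_real x)) \<in> borel_measurable \<mu>" for y
      by measurable
  qed
  \<comment> \<open>Integrate \<open>z / (z - x) = 1 + x / (z - x)\<close> against a measure of mass
    1.\<close>
  have G_eq: "z y * Cauchy_transform \<mu> (z y) = 1 + L y / z y" if y: "y > 0" for y
  proof -
    have "1 + L y / z y = (\<integral>x. 1 + (z y * of_real x / (z y - of_real x)) / z y \<partial>\<mu>)"
    proof -
      have "integrable \<mu> (\<lambda>x. z y * of_real x / (z y - of_real x))"
        by (rule Bochner_Integration.integrable_bound[OF int]) (use bound[OF y] in auto)
      moreover have "1 + (\<integral>x. g x \<partial>\<mu>) / z y = (\<integral>x. 1 + g x / z y \<partial>\<mu>)"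
        if "integrable \<mu> g" for g :: "real \<Rightarrow> complex"
        using that by (simp add: prob_space)
      ultimately show ?thesis
        by (simp only: L_def)
    qed
    also have "\<dots> = (\<integral>x. z y * (1 / (z y - complex_of_real x)) \<partial>\<mu>)"
      using ne[OF y] y by (intro Bochner_Integration.integral_cong) (auto simp: z_def field_simps)
    also have "\<dots> = z y * Cauchy_transform \<mu> (z y)"
      unfolding Cauchy_transform_def by (rule integral_mult_right_zero)
    finally show ?thesis by simp
  qed
  have Lz: "((\<lambda>y. L y / z y) \<longlongrightarrow> 0) at_top"
  proof -
    have "L y * of_real (inverse y) * - \<i> = L y / z y" for y
      by (simp add: z_def divide_inverse mult_ac)
    with tendsto_mult[OF tendsto_mult[OF L_lim inv_lim] tendsto_const[of "-\<i>"]]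
    show ?thesis by simp
  qed
  from Lz have "((\<lambda>y. L y / (1 + L y / z y)) \<longlongrightarrow> (\<integral>x. of_real x \<partial>\<mu>) / (1 + 0)) at_top"
    by (intro tendsto_intros L_lim) auto
  moreover have "\<forall>\<^sub>F y in at_top. L y / (1 + L y / z y) = z y - reciprocal_Cauchy_transform \<mu> (z y)"
  proof -
    \<comment> \<open>The limit 1 makes \<open>z y * Cauchy_transform \<mu> (z y)\<close> eventually
      nonzero, so the reciprocal is a genuine one for large \<open>y\<close>.\<close>
    have "((\<lambda>y. 1 + L y / z y) \<longlongrightarrow> 1 + 0) at_top"
      by (intro tendsto_intros Lz)
    then have "\<forall>\<^sub>F y in at_top. 1 + L y / z y \<noteq> 0"
      by (rule tendsto_imp_eventually_ne) simp
    then show ?thesis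
      using eventually_gt_at_top[of 0]
    proof eventually_elim
      case (elim y)
      then have "z y \<noteq> 0" "Cauchy_transform \<mu> (z y) \<noteq> 0"
        using G_eq[of y] by (auto simp: z_def)
      then have "L y = z y * (z y * Cauchy_transform \<mu> (z y) - 1)"
        using G_eq[of y] elim by (simp add: field_simps)
      with \<open>z y \<noteq> 0\<close> \<open>Cauchy_transform \<mu> (z y) \<noteq> 0\<close> show ?case
        unfolding G_eq[OF elim(2), symmetric] reciprocal_Cauchy_transform_def
        by (simp add: field_simps)
    qed
  qed
  ultimately have "((\<lambda>y. z y - reciprocal_Cauchy_transform \<mu> (z y))
      \<longlongrightarrow> (\<integral>x. of_real x \<partial>\<mu>)) at_top"
    by (simp add: Lim_transform_eventually)
  then show ?thesis
    by (simp add: z_def)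
qed

text \<open>The transform of a point mass subtracts \<open>x\<close>, so \<open>z\<close> minus the
  reciprocal transform is larger by \<open>x\<close> for \<open>\<rho>\<close> than for
  \<open>\<mu>\<close>. Integrability of both measures identifies both limits as means.\<close>

lemma monotone_convolution_return_mean:
  assumes "is_monotone_convolution (return borel x) \<mu> \<rho>"
    and "\<mu> \<in> space (prob_algebra borel)"
    and "integrable \<mu> (\<lambda>y. y)" and "integrable \<rho> (\<lambda>y. y)"
  shows "(\<integral>y. y \<partial>\<rho>) = x + (\<integral>y. y \<partial>\<mu>)"
proof -
  have \<rho>: "\<rho> \<in> space (prob_algebra borel)"
    using assms by (simp add: is_monotone_convolution_def)
  let ?F = "\<lambda>\<mu> y. reciprocal_Cauchy_transform \<mu> (\<i> * of_real y)"
  have "((\<lambda>y. of_real x + (\<i> * of_real y - ?F \<mu> y)) \<longlongrightarrow> of_real x + of_real (\<integral>x. x \<partial>\<mu>)) at_top"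
    using assms by (intro tendsto_intros reciprocal_Cauchy_transform_mean) (auto simp: space_prob_algebra)
  moreover have "\<forall>\<^sub>F y in at_top. of_real x + (\<i> * of_real y - ?F \<mu> y) = \<i> * of_real y - ?F \<rho> y"
    using assms(1) by (intro eventually_mono[OF eventually_gt_at_top[of 0]])
      (simp add: is_monotone_convolution_def reciprocal_Cauchy_transform_return)
  ultimately have "((\<lambda>y. \<i> * of_real y - ?F \<rho> y) \<longlongrightarrow> of_real x + of_real (\<integral>x. x \<partial>\<mu>)) at_top"
    by (rule Lim_transform_eventually)
  moreover have "((\<lambda>y. \<i> * of_real y - ?F \<rho> y) \<longlongrightarrow> of_real (\<integral>x. x \<partial>\<rho>)) at_top"
    using assms \<rho> by (intro reciprocal_Cauchy_transform_mean) (auto simp: space_prob_algebra)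
  ultimately have "complex_of_real x + of_real (\<integral>x. x \<partial>\<mu>) = of_real (\<integral>x. x \<partial>\<rho>)"
    by (rule tendsto_unique[rotated]) simp
  then show ?thesis
    by (simp flip: of_real_add)
qed

section \<open>The Markov property for integrals\<close>

text \<open>Integrals over the sets of \<open>F s\<close> characterize a conditional expectation.
  Taking \<open>f\<close> with values in \<open>ennreal\<close> makes the identity available before
  the kernels are known to have means.\<close>

lemma Markov_process_nn_set_integral:
  assumes M: "Markov_process P F k X" and st: "0 \<le> s" "s \<le> t"
    and A: "A \<in> sets (F s)" and f: "f \<in> borel_measurable borel"
  shows "(\<integral>\<^sup>+\<omega>\<in>A. f (X t \<omega>) \<partial>P) = (\<integral>\<^sup>+\<omega>\<in>A. (\<integral>\<^sup>+y. f y \<partial>k s t (X s \<omega>)) \<partial>P)"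
proof -
  interpret prob_space P
    using M by (simp add: Markov_process_def filtered_prob_space_def)
  have sub: "subalgebra P (F s)" "subalgebra P (F t)"
    using M st by (auto simp: Markov_process_def filtered_prob_space_def)
  interpret finite_measure_subalgebra P "F s"
    by unfold_locales (rule sub)
  have [measurable]: "A \<in> sets P"
    using A sub by (auto simp: subalgebra_def)
  have X[measurable]: "X s \<in> borel_measurable P" "X t \<in> borel_measurable P"
    using M st sub by (auto simp: Markov_process_def adapted_process_def intro: measurable_from_subalg)
  have k: "k s t \<in> borel \<rightarrow>\<^sub>M prob_algebra borel"
    using M st by (auto simp: Markov_process_def transition_kernels_def)
  note [measurable] = measurable_prob_algebraD[OF k]
  \<comment> \<open>\<open>P\<close> restricted to \<open>A\<close>, so that integrals over
    \<open>A\<close> become integrals against a measure.\<close>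
  let ?Q = "density P (indicator A)"
  let ?K = "\<lambda>\<omega>. k s t (X s \<omega>)"
  have K: "?K \<in> ?Q \<rightarrow>\<^sub>M subprob_algebra borel"
    by measurable
  have prob: "prob_space (k s t x)" "sets (k s t x) = sets borel" for x
    using measurable_space[OF k, of x] by (auto simp: space_prob_algebra)
  (* The Markov property for indicators is the equality of these measures; integrating
     f against both sides extends it to all nonnegative f. *)
  have "distr ?Q borel (X t) = ?Q \<bind> ?K"
  proof (rule measure_eqI)
    show "sets (distr ?Q borel (X t)) = sets (?Q \<bind> ?K)"
      using K not_empty by (simp add: sets_bind[where N = borel] prob)
    fix B assume "B \<in> sets (distr ?Q borel (X t))"
    then have B[measurable]: "B \<in> sets borel" by simp
    have [measurable]: "(\<lambda>\<omega>. measure (?K \<omega>) B) \<in> borel_measurable P"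
      by measurable
    \<comment> \<open>The Markov property concerns real conditional expectations, while emeasures
      are nonnegative integrals. These integrands are bounded by 1, hence integrable, which links
      the two.\<close>
    have int: "integrable P (\<lambda>\<omega>. indicator A \<omega> * measure (?K \<omega>) B)"
      by (rule integrable_const_bound[where B = 1])
        (auto simp: indicator_def prob_space.prob_le_1[OF prob(1)])
    have int': "integrable P (\<lambda>\<omega>. indicator B (X t \<omega>) :: real)"
      by (rule integrable_const_bound[where B = 1]) auto
    have int'': "integrable P (\<lambda>\<omega>. indicator A \<omega> * indicator B (X t \<omega>) :: real)"
      by (rule integrable_const_bound[where B = 1]) (auto simp: indicator_def)
    have "(\<integral>\<omega>. indicator A \<omega> * indicator B (X t \<omega>) \<partial>P)
        = (\<integral>\<omega>. indicator A \<omega> * real_cond_exp P (F s) (\<lambda>\<omega>. indicator B (X t \<omega>)) \<omega> \<partial>P)"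
      using real_cond_exp_intA[OF int' A] by (simp add: set_lebesgue_integral_def)
    also have "\<dots> = (\<integral>\<omega>. indicator A \<omega> * measure (?K \<omega>) B \<partial>P)"
    proof (rule integral_cong_AE)
      have "AE \<omega> in P. real_cond_exp P (F s) (\<lambda>\<omega>. indicator B (X t \<omega>)) \<omega> = measure (?K \<omega>) B"
        using M st B by (auto simp: Markov_process_def)
      then show "AE \<omega> in P. indicator A \<omega> * real_cond_exp P (F s) (\<lambda>\<omega>. indicator B (X t \<omega>)) \<omega>
          = indicator A \<omega> * measure (?K \<omega>) B"
        by eventually_elim simp
    qed measurable
    finally have eq: "(\<integral>\<omega>. indicator A \<omega> * indicator B (X t \<omega>) \<partial>P)
        = (\<integral>\<omega>. indicator A \<omega> * measure (?K \<omega>) B \<partial>P)" .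
    have "emeasure (distr ?Q borel (X t)) B = (\<integral>\<^sup>+\<omega>. indicator B \<omega> \<partial>distr ?Q borel (X t))"
      by simp
    also have "\<dots> = (\<integral>\<^sup>+\<omega>. indicator A \<omega> * indicator B (X t \<omega>) \<partial>P)"
      by (subst nn_integral_distr) (auto simp: nn_integral_density)
    also have "\<dots> = (\<integral>\<^sup>+\<omega>. ennreal (indicator A \<omega> * indicator B (X t \<omega>)) \<partial>P)"
      by (intro nn_integral_cong) (auto simp: indicator_def)
    also have "\<dots> = (\<integral>\<^sup>+\<omega>. ennreal (indicator A \<omega> * measure (?K \<omega>) B) \<partial>P)"
      using int int'' eq by (simp add: nn_integral_eq_integral)
    also have "\<dots> = (\<integral>\<^sup>+\<omega>. indicator A \<omega> * emeasure (?K \<omega>) B \<partial>P)"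
      using finite_measure.emeasure_eq_measure[OF prob_space.finite_measure[OF prob(1)]]
      by (intro nn_integral_cong) (auto simp: indicator_def)
    also have "\<dots> = emeasure (?Q \<bind> ?K) B"
      using not_empty by (subst emeasure_bind[OF _ K B]) (auto simp: nn_integral_density)
    finally show "emeasure (distr ?Q borel (X t)) B = emeasure (?Q \<bind> ?K) B" .
  qed
  then have "(\<integral>\<^sup>+y. f y \<partial>distr ?Q borel (X t)) = (\<integral>\<^sup>+y. f y \<partial>(?Q \<bind> ?K))"
    by simp
  moreover have "(\<integral>\<^sup>+y. f y \<partial>distr ?Q borel (X t)) = (\<integral>\<^sup>+\<omega>. indicator A \<omega> * f (X t \<omega>) \<partial>P)"
    using f by (simp add: nn_integral_distr nn_integral_density)
  moreover have "(\<integral>\<^sup>+y. f y \<partial>(?Q \<bind> ?K)) = (\<integral>\<^sup>+\<omega>. indicator A \<omega> * (\<integral>\<^sup>+y. f y \<partial>?K \<omega>) \<partial>P)"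
    using f nn_integral_measurable_subprob_algebra[OF f]
    by (simp add: nn_integral_bind[OF f K] nn_integral_density)
  ultimately show ?thesis
    by (simp add: mult.commute)
qed

text \<open>The absolute first moments of the kernels average to that of \<open>X t\<close>, so
  almost all of them are finite. The conditional mean is then assembled from positive and negative
  parts.\<close>

lemma Markov_process_cond_exp:
  assumes M: "Markov_process P F k X" and st: "0 \<le> s" "s \<le> t"
    and int: "integrable P (X t)"
  shows "AE \<omega> in P. integrable (k s t (X s \<omega>)) (\<lambda>y. y)"
    and "AE \<omega> in P. real_cond_exp P (F s) (X t) \<omega> = (\<integral>y. y \<partial>k s t (X s \<omega>))"
proof -
  interpret prob_space P
    using M by (simp add: Markov_process_def filtered_prob_space_def)
  have sub: "subalgebra P (F s)" "subalgebra P (F t)"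
    using M st by (auto simp: Markov_process_def filtered_prob_space_def)
  interpret finite_measure_subalgebra P "F s"
    by unfold_locales (rule sub)
  have XF[measurable]: "X s \<in> borel_measurable (F s)"
    using M st by (auto simp: Markov_process_def adapted_process_def)
  have X[measurable]: "X s \<in> borel_measurable P" "X t \<in> borel_measurable P"
    using M st sub by (auto simp: Markov_process_def adapted_process_def intro: measurable_from_subalg)
  have k: "k s t \<in> borel \<rightarrow>\<^sub>M prob_algebra borel"
    using M st by (auto simp: Markov_process_def transition_kernels_def)
  note [measurable] = measurable_prob_algebraD[OF k]
  have sets_k: "sets (k s t x) = sets borel" for x
    using measurable_space[OF k, of x] by (auto simp: space_prob_algebra)
  have "(\<integral>\<^sup>+\<omega>\<in>space P. (\<integral>\<^sup>+y. ennreal (norm y) \<partial>k s t (X s \<omega>)) \<partial>P)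
      = (\<integral>\<^sup>+\<omega>\<in>space P. ennreal (norm (X t \<omega>)) \<partial>P)"
    using sub sets.top[of "F s"]
    by (intro Markov_process_nn_set_integral[OF M st, symmetric]) (auto simp: subalgebra_def)
  then have "(\<integral>\<^sup>+\<omega>. (\<integral>\<^sup>+y. ennreal (norm y) \<partial>k s t (X s \<omega>)) \<partial>P) \<noteq> \<infinity>"
    using int by (simp add: nn_set_integral_space integrable_iff_bounded)
  then have "AE \<omega> in P. (\<integral>\<^sup>+y. ennreal (norm y) \<partial>k s t (X s \<omega>)) \<noteq> \<infinity>"
    by (intro nn_integral_PInf_AE) measurable
  then show int_k: "AE \<omega> in P. integrable (k s t (X s \<omega>)) (\<lambda>y. y)"
    by eventually_elim (auto simp: integrable_iff_bounded sets_k less_top cong: measurable_cong_sets)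
  have ce: "AE \<omega> in P. (\<integral>\<^sup>+y. f y \<partial>k s t (X s \<omega>)) = nn_cond_exp P (F s) (\<lambda>\<omega>. f (X t \<omega>)) \<omega>"
    if [measurable]: "f \<in> borel_measurable borel" for f
    by (rule nn_cond_exp_charact) (auto simp: Markov_process_nn_set_integral[OF M st])
  \<comment> \<open>Since \<open>ennreal\<close> sends negative numbers to 0, these are the positive
    and negative parts. Both \<open>real_cond_exp\<close> and the integral of an integrable function
    are differences built from them.\<close>
  have "(\<lambda>y. ennreal y) \<in> borel_measurable borel" "(\<lambda>y. ennreal (- y)) \<in> borel_measurable borel"
    by measurable
  from ce[OF this(1)] ce[OF this(2)] int_k
  show "AE \<omega> in P. real_cond_exp P (F s) (X t) \<omega> = (\<integral>y. y \<partial>k s t (X s \<omega>))"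
    by eventually_elim (simp add: real_cond_exp_def real_lebesgue_integral_def)
qed

section \<open>The martingale property\<close>

theorem proposition4p36:
  fixes P :: "'a measure"
    and F :: "real \<Rightarrow> 'a measure"
    and k :: "real \<Rightarrow> real \<Rightarrow> real \<Rightarrow> real measure"
    and M :: "real \<Rightarrow> 'a \<Rightarrow> real"
  assumes "monotone_homogeneous_Markov_process P F k M"
    and "AE \<omega> in P. M 0 \<omega> = 0"
    and "\<And>t. t > 0 \<Longrightarrow> integrable P (M t)"
  shows "martingale P F (\<lambda>t \<omega>. M t \<omega> - (\<integral>\<omega>'. M t \<omega>' \<partial>P))"
proof -
  have Markov: "Markov_process P F k M" and hom: "monotone_homogeneous k"
    using assms(1) by (auto simp: monotone_homogeneous_Markov_process_def)
  have fil: "filtered_prob_space P F" and ad: "adapted_process F M"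
    using Markov by (auto simp: Markov_process_def)
  interpret prob_space P
    using fil by (simp add: filtered_prob_space_def)
  have meas_F: "M t \<in> borel_measurable (F t)" and sub: "subalgebra P (F t)" if "t \<ge> 0" for t
    using fil ad that by (auto simp: filtered_prob_space_def adapted_process_def)
  \<comment> \<open>Time 0 is where the initial condition enters: \<open>M 0\<close> vanishes almost
    everywhere.\<close>
  have int: "integrable P (M t)" if "t \<ge> 0" for t
  proof (cases "t = 0")
    case True
    have "M 0 \<in> borel_measurable P"
      using measurable_from_subalg[OF sub meas_F] by simp
    then have "integrable P (M 0) \<longleftrightarrow> integrable P (\<lambda>_. 0 :: real)"
      using assms(2) by (intro integrable_cong_AE) auto
    with True show ?thesis by simp
  qed (use assms(3) that in auto)
  have "AE \<omega> in P. real_cond_exp P (F s) (\<lambda>\<omega>. M t \<omega> - expectation (M t)) \<omega>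
      = M s \<omega> - expectation (M s)" if st: "0 \<le> s" "s \<le> t" for s t
  proof -
    interpret finite_measure_subalgebra P "F s"
      by unfold_locales (rule sub[OF st(1)])
    have int_t: "integrable P (M t)" using int st by simp
    note cond = Markov_process_cond_exp[OF Markov st int_t]
    have "k s t \<in> borel \<rightarrow>\<^sub>M prob_algebra borel"
      using Markov st by (auto simp: Markov_process_def transition_kernels_def)
    then have k: "k s t x \<in> space (prob_algebra borel)" for x
      by (rule measurable_space) simp
    (* Integrability of M t gives a mean of k s t x only for almost every value x of M s,
       which may exclude x = 0, so c is read off at some other point. *)
    from eventually_happens'[OF ae_filter_bot cond(1)] obtain x\<^sub>0
      where x\<^sub>0: "integrable (k s t x\<^sub>0) (\<lambda>y. y)"
      by blast
    define c where "c = (\<integral>y. y \<partial>k s t x\<^sub>0) - x\<^sub>0"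
    have mean: "(\<integral>y. y \<partial>k s t x) = x + c" if "integrable (k s t x) (\<lambda>y. y)" for x
    proof -
      \<comment> \<open>Homogeneity at the base point \<open>x\<^sub>0\<close> with shift
        \<open>x - x\<^sub>0\<close> reaches \<open>k s t x\<close>.\<close>
      have "is_monotone_convolution (return borel (x - x\<^sub>0)) (k s t x\<^sub>0) (k s t ((x - x\<^sub>0) + x\<^sub>0))"
        using hom st unfolding monotone_homogeneous_def by blast
      from monotone_convolution_return_mean[OF _ k x\<^sub>0 that] this show ?thesis
        by (simp add: c_def)
    qed
    from cond have ce: "AE \<omega> in P. real_cond_exp P (F s) (M t) \<omega> = M s \<omega> + c"
      by eventually_elim (simp add: mean)
    have "expectation (M t) = expectation (real_cond_exp P (F s) (M t))"
      by (rule real_cond_exp_int(2)[OF int_t, symmetric])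
    also have "\<dots> = expectation (\<lambda>\<omega>. M s \<omega> + c)"
      using ce int[OF st(1)] by (intro integral_cong_AE) auto
    also have "\<dots> = expectation (M s) + c"
      using int[OF st(1)] by (simp add: prob_space)
    finally have c: "expectation (M t) = expectation (M s) + c" .
    have const: "AE \<omega> in P. real_cond_exp P (F s) (\<lambda>_. expectation (M t)) \<omega> = expectation (M t)"
      by (rule real_cond_exp_F_meas) auto
    from real_cond_exp_diff[OF int_t, of "\<lambda>_. expectation (M t)"] have
      "AE \<omega> in P. real_cond_exp P (F s) (\<lambda>\<omega>. M t \<omega> - expectation (M t)) \<omega>
        = real_cond_exp P (F s) (M t) \<omega> - real_cond_exp P (F s) (\<lambda>_. expectation (M t)) \<omega>"
      by simp
    \<comment> \<open>By \<open>c\<close>, the right-hand side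
      \<open>M s + c - expectation (M t)\<close> is \<open>M s - expectation (M s)\<close>.\<close>
    with ce const show ?thesis
      by eventually_elim (simp add: c)
  qed
  with fil ad int show ?thesis
    unfolding martingale_def adapted_process_def by auto
qed

end
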